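(* Let $G\in\mathbf{RH}_\infty$. Let $N\ge 1$, $0<\omega_1\le\cdots\le\omega_N\le\pi$, and $\lambda_1,\dots,\lambda_N\ge 0$, where at least one $\lambda_r$ is nonzero. (i) If $$\sum_{r=1}^{N}\mathrm{Re}\{\lambda_rG(e^{j\omega_r})\}\le\min_{i\in\mathbb{Z}}\left[\sum_{r=1}^{N}\mathrm{Re}\{\lambda_rG(e^{j\omega_r})e^{-j\omega_ri}\}\right],$$ then there is no $M\in\mathcal{M}$ such that $\mathrm{Re}\{M(e^{j\omega})G(e^{j\omega})\}>0$ for all $\omega\in[0,\pi]$. (ii) If $$\sum_{r=1}^{N}\mathrm{Re}\{\lambda_rG(e^{j\omega_r})\}\le-\max_{i\in\mathbb{Z}}\left|\sum_{r=1}^{N}\mathrm{Re}\{\lambda_rG(e^{j\omega_r})e^{-j\omega_ri}\}\right|,$$ then there is no $M\in\mathcal{M}_{\text{odd}}$ such that $\mathrm{Re}\{M(e^{j\omega})G(e^{j\omega})\}>0$ for all $\omega\in[0,\pi]$.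
   Context: $j$ is the imaginary unit. $\mathbf{RH}_\infty$ is the set of scalar proper rational functions $G(z)$ with real coefficients all of whose poles lie in the open unit disk. An inequality "$x\le\min_i y_i$" means $x\le y_i$ for all $i\in\mathbb{Z}$, and "$x\le-\max_i|y_i|$" means $x\le-|y_i|$ for all $i\in\mathbb{Z}$. For a real two-sided sequence $h=(h_i)_{i\in\mathbb{Z}}$, $\|h\|_1=\sum_{i\in\mathbb{Z}}|h_i|$. Discrete-time LTI Zames-Falb multipliers: $\mathcal{M}$ is the set of functions on the unit circle of the form $M(e^{j\omega})=1-H(e^{j\omega})$, $H(e^{j\omega})=\sum_{i\in\mathbb{Z}}h_ie^{-j\omega i}$, where $h$ is a real sequence with $h_0=0$, $h_i\ge 0$ for all $i$ and $\|h\|_1\le 1$. $\mathcal{M}_{\text{odd}}$ is the set of such functions where $h$ is a real sequence with $h_0=0$ and $\|h\|_1\le 1$ (no sign condition). *)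

theory Defs
  imports "HOL-Analysis.Analysis" "HOL-Computational_Algebra.Computational_Algebra"
begin

text \<open>
  A rational function is represented by its evaluation map on the complex plane.
  The quotient is in lowest terms, so the poles are exactly the complex roots of the denominator;
  there the value is \<^term>\<open>0\<close> by the convention for division, but this is irrelevant
  on the unit circle, where elements of \<open>RH_inf\<close> have no poles.
\<close>

definition RH_inf :: "(complex \<Rightarrow> complex) set" where
  "RH_inf = {G. \<exists>p q :: real poly.
      q \<noteq> 0 \<and> coprime p q \<and> degree p \<le> degree q \<and>
      (\<forall>z. poly (map_poly complex_of_real q) z = 0 \<longrightarrow> cmod z < 1) \<and>
      (\<forall>z. G z = poly (map_poly complex_of_real p) z / poly (map_poly complex_of_real q) z)}"

definition l1_norm_le_1 :: "(int \<Rightarrow> real) \<Rightarrow> bool" where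
  "l1_norm_le_1 h \<longleftrightarrow>
     (\<lambda>i. \<bar>h i\<bar>) summable_on UNIV \<and> (\<Sum>\<^sub>\<infinity>i. \<bar>h i\<bar>) \<le> 1"

definition freq_response :: "(int \<Rightarrow> real) \<Rightarrow> real \<Rightarrow> complex" where
  "freq_response h \<omega> = (\<Sum>\<^sub>\<infinity>i. complex_of_real (h i) * cis (- (\<omega> * of_int i)))"

text \<open>
  Multipliers are functions on the unit circle: only the values at points
  \<^term>\<open>cis \<omega>\<close> are constrained.
\<close>

definition ZF :: "(complex \<Rightarrow> complex) set" where
  "ZF = {M. \<exists>h :: int \<Rightarrow> real. h 0 = 0 \<and> (\<forall>i. h i \<ge> 0) \<and> l1_norm_le_1 h \<and>
      (\<forall>\<omega>. M (cis \<omega>) = 1 - freq_response h \<omega>)}"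

definition ZF_odd :: "(complex \<Rightarrow> complex) set" where
  "ZF_odd = {M. \<exists>h :: int \<Rightarrow> real. h 0 = 0 \<and> l1_norm_le_1 h \<and>
      (\<forall>\<omega>. M (cis \<omega>) = 1 - freq_response h \<omega>)}"

end

theory Submission
  imports Defs
begin

text \<open>
  Put \<open>z\<^sub>r = cis \<omega>\<^sub>r\<close> and \<open>a\<^sub>i = \<Sum>\<^sub>r Re (\<lambda>\<^sub>r G(z\<^sub>r) z\<^sub>r\<^bsup>-i\<^esup>)\<close>. For a multiplier \<open>M = 1 - H\<close>, the weighted sum
  \<open>\<Sum>\<^sub>r \<lambda>\<^sub>r Re (M(z\<^sub>r) G(z\<^sub>r))\<close> equals \<open>a\<^sub>0 - \<Sum>\<^sub>i h\<^sub>i a\<^sub>i\<close>, and it would be positive if \<open>Re (M G)\<close> were.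
  If \<open>a\<^sub>0 \<le> 0\<close>, the bound on the \<open>a\<^sub>i\<close> and \<open>\<parallel>h\<parallel>\<^sub>1 \<le> 1\<close> give \<open>\<Sum>\<^sub>i h\<^sub>i a\<^sub>i \<ge> a\<^sub>0\<close>, a contradiction.
  In the odd case \<open>a\<^sub>0 \<le> 0\<close> is the hypothesis at \<open>i = 0\<close>. In the other case it holds because no
  \<open>\<omega>\<^sub>r\<close> is a multiple of \<open>2\<pi>\<close>, so that the Cesaro means of \<open>a\<^sub>i\<close> tend to \<open>0\<close>.
\<close>

text \<open>The numerator \<open>1 - z ^ n\<close> of the closed form has modulus at most 2, so the
  bound is uniform in \<open>n\<close>.\<close>

lemma cmod_sum_powers_le:
  fixes z :: complex
  assumes "cmod z = 1" "z \<noteq> 1"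
  shows "cmod (\<Sum>k<n. z ^ k) \<le> 2 / cmod (1 - z)"
proof -
  have "cmod (1 - z ^ n) \<le> 2"
    using norm_triangle_ineq4[of 1 "z ^ n"] assms by (simp add: norm_power)
  moreover have "(\<Sum>k<n. z ^ k) = (1 - z ^ n) / (1 - z)"
    using assms(2) by (simp add: sum_gp_strict)
  ultimately show ?thesis
    by (simp add: norm_divide divide_right_mono)
qed

text \<open>Adding the lower bound over \<open>k < n\<close> gives \<open>n * S\<close> on the left,
  while the right side consists of geometric sums with ratios other than 1 and stays bounded in
  \<open>n\<close>. A positive \<open>S\<close> would violate the Archimedean property.\<close>

lemma trig_sum_lower_bound_nonpos:
  fixes c :: "'a \<Rightarrow> complex" and \<theta> :: "'a \<Rightarrow> real"
  assumes "\<And>r. r \<in> A \<Longrightarrow> cis (\<theta> r) \<noteq> 1"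
    and lb: "\<And>k::nat. S \<le> (\<Sum>r\<in>A. Re (c r * cis (- (\<theta> r * of_nat k))))"
  shows "S \<le> 0"
proof (rule ccontr)
  assume "\<not> S \<le> 0"
  define z where "z r = cis (- \<theta> r)" for r
  define C where "C = (\<Sum>r\<in>A. cmod (c r) * (2 / cmod (1 - z r)))"
  \<comment> \<open>\<open>z r\<close> is the conjugate of \<open>cis (\<theta> r)\<close>.\<close>
  have z1: "z r \<noteq> 1" if "r \<in> A" for r
    using assms(1)[OF that] by (auto simp: z_def complex_eq_iff)
  have bound: "real n * S \<le> C" for n :: nat
  proof -
    have "real n * S \<le> (\<Sum>k<n. \<Sum>r\<in>A. Re (c r * cis (- (\<theta> r * of_nat k))))"
      using sum_mono[of "{..<n}" "\<lambda>_. S", OF lb] by simp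
    also have "\<dots> = (\<Sum>k<n. \<Sum>r\<in>A. Re (c r * z r ^ k))"
      by (simp add: z_def Complex.DeMoivre mult.commute)
    also have "\<dots> = (\<Sum>r\<in>A. Re (c r * (\<Sum>k<n. z r ^ k)))"
      by (subst sum.swap) (simp only: sum_distrib_left Re_sum)
    also have "\<dots> \<le> C"
      unfolding C_def
    proof (rule sum_mono)
      fix r assume "r \<in> A"
      have "Re (c r * (\<Sum>k<n. z r ^ k)) \<le> cmod (c r) * cmod (\<Sum>k<n. z r ^ k)"
        by (metis complex_Re_le_cmod norm_mult)
      also have "\<dots> \<le> cmod (c r) * (2 / cmod (1 - z r))"
        using z1[OF \<open>r \<in> A\<close>] by (intro mult_left_mono cmod_sum_powers_le) (simp_all add: z_def)
      finally show "Re (c r * (\<Sum>k<n. z r ^ k)) \<le> cmod (c r) * (2 / cmod (1 - z r))" .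
    qed
    finally show ?thesis .
  qed
  obtain n :: nat where "C < real n * S"
    using \<open>\<not> S \<le> 0\<close> reals_Archimedean3[of S] by auto
  with bound[of n] show False by simp
qed

lemma has_sum_freq_response:
  assumes "(\<lambda>i. \<bar>h i\<bar>) summable_on UNIV"
  shows "((\<lambda>i. complex_of_real (h i) * cis (- (w * of_int i))) has_sum freq_response h w) UNIV"
proof -
  have "(\<lambda>i. cmod (complex_of_real (h i) * cis (- (w * of_int i)))) summable_on UNIV"
    using assms by (simp add: norm_mult)
  then have "(\<lambda>i. complex_of_real (h i) * cis (- (w * of_int i))) summable_on UNIV"
    by (rule abs_summable_summable)
  then show ?thesis
    unfolding freq_response_def by (rule has_sum_infsum)
qed

lemma has_sum_finite_sum:
  fixes f :: "'a \<Rightarrow> 'b \<Rightarrow> 'c::topological_comm_monoid_add"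
  assumes "\<And>r. r \<in> A \<Longrightarrow> (f r has_sum s r) B"
  shows "((\<lambda>i. \<Sum>r\<in>A. f r i) has_sum (\<Sum>r\<in>A. s r)) B"
  using assms by (induction A rule: infinite_finite_induct) (auto intro: has_sum_add)

text \<open>Exchanges the finite sum over frequencies with the series over \<open>i\<close>; the
  real coefficient \<open>h i\<close> passes through \<open>Re\<close>.\<close>

lemma has_sum_weighted_freq_response:
  fixes c :: "'a \<Rightarrow> complex" and \<theta> :: "'a \<Rightarrow> real"
  assumes "(\<lambda>i. \<bar>h i\<bar>) summable_on UNIV"
  shows "((\<lambda>i. h i * (\<Sum>r\<in>A. Re (c r * cis (- (\<theta> r * of_int i)))))
           has_sum (\<Sum>r\<in>A. Re (c r * freq_response h (\<theta> r)))) UNIV"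
proof -
  have "((\<lambda>i. \<Sum>r\<in>A. Re (c r * (complex_of_real (h i) * cis (- (\<theta> r * of_int i)))))
           has_sum (\<Sum>r\<in>A. Re (c r * freq_response h (\<theta> r)))) UNIV"
    by (intro has_sum_finite_sum has_sum_Re has_sum_cmult_right has_sum_freq_response assms)
  moreover have "Re (c r * (complex_of_real x * y)) = x * Re (c r * y)" for r x y
    by (simp add: algebra_simps)
  ultimately show ?thesis
    by (simp only: sum_distrib_left)
qed

text \<open>Writing \<open>lb\<close> with \<open>\<bar>h i\<bar>\<close> lets it serve both
  multiplier classes. Summed over \<open>i\<close>, it bounds the contribution of the frequency
  response below by the l1 norm of \<open>h\<close> times \<open>S\<close>.\<close>

lemma weighted_multiplier_sum_nonpos:
  fixes c :: "'a \<Rightarrow> complex" and \<theta> :: "'a \<Rightarrow> real"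
  assumes h: "l1_norm_le_1 h" and S: "S = (\<Sum>r\<in>A. Re (c r))" "S \<le> 0"
    and lb: "\<And>i. \<bar>h i\<bar> * S \<le> h i * (\<Sum>r\<in>A. Re (c r * cis (- (\<theta> r * of_int i))))"
  shows "(\<Sum>r\<in>A. Re (c r * (1 - freq_response h (\<theta> r)))) \<le> 0"
proof -
  have summ: "(\<lambda>i. \<bar>h i\<bar>) summable_on UNIV" and le1: "(\<Sum>\<^sub>\<infinity>i. \<bar>h i\<bar>) \<le> 1"
    using h by (auto simp: l1_norm_le_1_def)
  have "((\<lambda>i. \<bar>h i\<bar> * S) has_sum (\<Sum>\<^sub>\<infinity>i. \<bar>h i\<bar>) * S) UNIV"
    using summ by (intro has_sum_cmult_left has_sum_infsum)
  then have "(\<Sum>\<^sub>\<infinity>i. \<bar>h i\<bar>) * S \<le> (\<Sum>r\<in>A. Re (c r * freq_response h (\<theta> r)))"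
    using has_sum_weighted_freq_response[OF summ] by (rule has_sum_mono) (rule lb)
  \<comment> \<open>Since \<open>S\<close> is nonpositive, multiplying the norm bound by it reverses
    the inequality.\<close>
  moreover have "S \<le> (\<Sum>\<^sub>\<infinity>i. \<bar>h i\<bar>) * S"
    using mult_right_mono_neg[OF le1 S(2)] by simp
  moreover have "(\<Sum>r\<in>A. Re (c r * (1 - freq_response h (\<theta> r))))
      = S - (\<Sum>r\<in>A. Re (c r * freq_response h (\<theta> r)))"
    unfolding S(1) sum_subtractf[symmetric] by (simp add: algebra_simps)
  ultimately show ?thesis by linarith
qed

theorem theorem4:
  fixes G :: "complex \<Rightarrow> complex" and N :: nat and \<omega> lam :: "nat \<Rightarrow> real"
  assumes "G \<in> RH_inf"
    and "N \<ge> 1"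
    and "0 < \<omega> 1" and "mono_on {1..N} \<omega>" and "\<omega> N \<le> pi"
    and "\<forall>r\<in>{1..N}. lam r \<ge> 0" and "\<exists>r\<in>{1..N}. lam r \<noteq> 0"
  shows "((\<forall>i::int. (\<Sum>r=1..N. Re (lam r * G (cis (\<omega> r))))
              \<le> (\<Sum>r=1..N. Re (lam r * G (cis (\<omega> r)) * cis (- (\<omega> r * of_int i)))))
           \<longrightarrow> \<not> (\<exists>M\<in>ZF. \<forall>w\<in>{0..pi}. Re (M (cis w) * G (cis w)) > 0))
       \<and> ((\<forall>i::int. (\<Sum>r=1..N. Re (lam r * G (cis (\<omega> r))))
              \<le> - \<bar>\<Sum>r=1..N. Re (lam r * G (cis (\<omega> r)) * cis (- (\<omega> r * of_int i)))\<bar>)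
           \<longrightarrow> \<not> (\<exists>M\<in>ZF_odd. \<forall>w\<in>{0..pi}. Re (M (cis w) * G (cis w)) > 0))"
proof -
  define c where "c r = complex_of_real (lam r) * G (cis (\<omega> r))" for r
  define S where "S = (\<Sum>r=1..N. Re (c r))"
  define a where "a i = (\<Sum>r=1..N. Re (c r * cis (- (\<omega> r * of_int i))))" for i :: int
  have range: "0 < \<omega> r" "\<omega> r \<le> pi" if "r \<in> {1..N}" for r
  proof -
    have "\<omega> 1 \<le> \<omega> r" "\<omega> r \<le> \<omega> N"
      using that \<open>N \<ge> 1\<close> by (auto intro!: mono_onD[OF \<open>mono_on {1..N} \<omega>\<close>])
    then show "0 < \<omega> r" "\<omega> r \<le> pi" using assms by auto
  qed
  \<comment> \<open>Shared by both parts, which differ only in how \<open>S \<le> 0\<close> and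
    \<open>lb\<close> are obtained.\<close>
  have contra: False
    if M: "\<And>w. M (cis w) = 1 - freq_response h w" and h: "l1_norm_le_1 h" and "S \<le> 0"
      and lb: "\<And>i. \<bar>h i\<bar> * S \<le> h i * a i"
      and pos: "\<forall>w\<in>{0..pi}. Re (M (cis w) * G (cis w)) > 0"
    for M h
  proof -
    have eq: "Re (c r * (1 - freq_response h (\<omega> r)))
        = lam r * Re (M (cis (\<omega> r)) * G (cis (\<omega> r)))" for r
      unfolding M c_def by (simp add: algebra_simps)
    have nonpos: "(\<Sum>r=1..N. Re (c r * (1 - freq_response h (\<omega> r)))) \<le> 0"
      using lb unfolding a_def by (intro weighted_multiplier_sum_nonpos[OF h S_def \<open>S \<le> 0\<close>])
    have pos': "Re (M (cis (\<omega> r)) * G (cis (\<omega> r))) > 0" if "r \<in> {1..N}" for r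
      using pos range[OF that] by simp
    obtain s where s: "s \<in> {1..N}" "lam s \<noteq> 0" using assms by blast
    \<comment> \<open>All terms are nonnegative, and the one at \<open>s\<close> is strictly
      positive.\<close>
    have "(\<Sum>r=1..N. lam r * Re (M (cis (\<omega> r)) * G (cis (\<omega> r)))) > 0"
    proof (rule sum_pos2[OF _ s(1)])
      have "lam s > 0" using s assms(6) by (simp add: order.not_eq_order_implies_strict)
      then show "lam s * Re (M (cis (\<omega> s)) * G (cis (\<omega> s))) > 0"
        using pos'[OF s(1)] by (rule mult_pos_pos)
    next
      show "lam r * Re (M (cis (\<omega> r)) * G (cis (\<omega> r))) \<ge> 0" if "r \<in> {1..N}" for r
        using assms(6) that by (intro mult_nonneg_nonneg less_imp_le[OF pos']) auto
    qed simp
    with nonpos show False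
      by (simp only: eq)
  qed
  have "\<not> (\<exists>M\<in>ZF. \<forall>w\<in>{0..pi}. Re (M (cis w) * G (cis w)) > 0)"
    if lb: "\<forall>i. S \<le> a i"
  proof
    assume "\<exists>M\<in>ZF. \<forall>w\<in>{0..pi}. Re (M (cis w) * G (cis w)) > 0"
    then obtain M h where *: "\<forall>i. h i \<ge> 0" "l1_norm_le_1 h"
        "\<And>w. M (cis w) = 1 - freq_response h w"
        "\<forall>w\<in>{0..pi}. Re (M (cis w) * G (cis w)) > 0"
      unfolding ZF_def by blast
    have "S \<le> 0"
    proof (rule trig_sum_lower_bound_nonpos)
      show "cis (\<omega> r) \<noteq> 1" if "r \<in> {1..N}" for r
      proof
        assume "cis (\<omega> r) = 1"
        \<comment> \<open>The cosine is injective on \<open>{0..pi}\<close>, so the value 1 is taken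
          only at 0.\<close>
        then have "cos (\<omega> r) = cos 0" by (simp add: complex_eq_iff)
        then have "\<omega> r = 0"
          using range[OF that] cos_inj_pi[of "\<omega> r" 0] by simp
        then show False using range[OF that] by simp
      qed
      show "S \<le> (\<Sum>r=1..N. Re (c r * cis (- (\<omega> r * of_nat k))))" for k
        using lb[rule_format, of "int k"] by (simp add: a_def)
    qed
    \<comment> \<open>Here \<open>\<bar>h i\<bar> = h i\<close>, so the bound on \<open>a i\<close>
      is scaled by a nonnegative factor.\<close>
    moreover have "\<bar>h i\<bar> * S \<le> h i * a i" for i
      using * lb by (simp add: mult_left_mono)
    ultimately show False using contra *(2-4) by blast
  qed
  moreover have "\<not> (\<exists>M\<in>ZF_odd. \<forall>w\<in>{0..pi}. Re (M (cis w) * G (cis w)) > 0)"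
    if ub: "\<forall>i. S \<le> - \<bar>a i\<bar>"
  proof
    assume "\<exists>M\<in>ZF_odd. \<forall>w\<in>{0..pi}. Re (M (cis w) * G (cis w)) > 0"
    then obtain M h where *: "l1_norm_le_1 h"
        "\<And>w. M (cis w) = 1 - freq_response h w"
        "\<forall>w\<in>{0..pi}. Re (M (cis w) * G (cis w)) > 0"
      unfolding ZF_odd_def by blast
    have "S \<le> 0" using ub[rule_format, of 0] by linarith
    \<comment> \<open>The sign of \<open>h i\<close> is unknown, so the estimate passes through
      \<open>- \<bar>h i * a i\<bar>\<close>, a lower bound for either sign.\<close>
    moreover have "\<bar>h i\<bar> * S \<le> h i * a i" for i
    proof -
      have "\<bar>h i\<bar> * S \<le> \<bar>h i\<bar> * - \<bar>a i\<bar>"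
        using ub by (intro mult_left_mono) auto
      also have "\<dots> = - \<bar>h i * a i\<bar>" by (simp add: abs_mult)
      also have "\<dots> \<le> h i * a i" by linarith
      finally show ?thesis .
    qed
    ultimately show False using contra * by blast
  qed
  ultimately show ?thesis
    unfolding S_def a_def c_def by blast
qed

end
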